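(* Let $i\in I$ and $b_1,b_2\in B$. If $\widetilde f_i(b_1\otimes b_2)\ne0$, then $$F\bigl(\widetilde f_i(b_1\otimes b_2)\bigr)=\begin{cases}F(b_1\otimes b_2)-1,&\text{if }\varphi_i(b_1)>\varepsilon_i(b_2),\\ F(b_1\otimes b_2)+1,&\text{if }\varphi_i(b_1)\le\varepsilon_i(b_2).\end{cases}$$
   Context: **The crystal $B$.** Let $X$ be one of the affine types $G_2^{(1)}, D_4^{(3)}, F_4^{(1)}, E_6^{(2)}, E_6^{(1)}, E_7^{(1)}, E_8^{(1)}$, with index set $I=\{0,1,\dots,n\}$ and simple roots $\alpha_0,\dots,\alpha_n$. Let $\Phi^0$ be the finite root system with simple roots $\alpha_1,\dots,\alpha_n$ obtained by removing the node $0$ from the affine Dynkin diagram: it is $G_2$ for $X=G_2^{(1)},D_4^{(3)}$; $F_4$ for $X=F_4^{(1)},E_6^{(2)}$; and $E_k$ for $X=E_k^{(1)}$ ($k=6,7,8$). Define $R^+,R^-,\Sigma,\theta$ as follows. - For $G_2^{(1)},F_4^{(1)},E_6^{(1)},E_7^{(1)},E_8^{(1)}$: $R^{+}$ (resp. $R^-$) is the set of all positive (resp. negative) roots of $\Phi^0$, $\Sigma$ is the set of all simple roots of $\Phi^0$, and $\theta$ is the highest root. - For $D_4^{(3)},E_6^{(2)}$: $R^+$ (resp. $R^-$) is the set of positive (resp. negative) short roots of $\Phi^0$, $\Sigma$ is the set of short simple roots of $\Phi^0$, and $\theta$ is the highest short root. The null root is $\delta=\alpha_0+\theta$. For $\alpha=\sum_j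 c_j\alpha_j$ put $\operatorname{ht}(\alpha)=\sum_j c_j$; thus $\operatorname{ht}(\delta)=\operatorname{ht}(\theta)+1$. Let $B=\{x_{\pm\alpha}\mid\alpha\in R^+\}\sqcup\{r_{\alpha_i}\mid\alpha_i\in\Sigma\}\sqcup\{\phi\}$, with arrows labelled by $I$ as follows ($b\xrightarrow{i}b'$ means $\widetilde f_i b=b'$ and $\widetilde e_i b'=b$; $\widetilde f_i b=0$ if no $i$-arrow leaves $b$, $\widetilde e_i b=0$ if no $i$-arrow enters $b$): - for $i\ne0$: $x_\alpha\xrightarrow{i}x_\beta$ iff $\alpha-\alpha_i=\beta$ ($\alpha,\beta\in R^+\cup R^-$); and $x_{\alpha_i}\xrightarrow{i}r_{\alpha_i}\xrightarrow{i}x_{-\alpha_i}$ for $\alpha_i\in\Sigma$; - for $i=0$: $x_\alpha\xrightarrow{0}x_\beta$ iff $\alpha+\theta=\beta$ ($\alpha\in R^-\setminus\{-\theta\}$, $\beta\in R^+$); and $x_{-\theta}\xrightarrow{0}\phi\xrightarrow{0}x_\theta$. Let $\varepsilon_i(b)=\max\{k\ge0\mid\widetilde e_i^{\,k}b\ne0\}$, $\varphi_i(b)=\max\{k\ge0\mid\widetilde f_i^{\,k}b\neq0\}$. The classical weight is $\overline{\mathrm{wt}}(x_{\pm\alpha})=\pm\alpha$, $\overline{\mathrm{wt}}(r_{\alpha_i})=\overline{\mathrm{wt}}(\phi)=0$. On $B\otimes B$ (the set of pairs $b_1\otimes b_2$) the tensor product rule is $\widetilde f_i(b_1\otimes b_2)=(\widetilde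 f_ib_1)\otimes b_2$ if $\varphi_i(b_1)>\varepsilon_i(b_2)$, and $=b_1\otimes(\widetilde f_ib_2)$ if $\varphi_i(b_1)\le\varepsilon_i(b_2)$ (with $b\otimes0=0\otimes b=0$). $B$ is a perfect crystal of level one, and in particular $B\otimes B$ is connected (known). **Energy function.** $H:B\otimes B\to\mathbb Z$ is the (unique, known to exist) map with $H(\phi\otimes\phi)=0$ such that whenever $\widetilde f_i(b_1\otimes b_2)\ne0$: $H(\widetilde f_i(b_1\otimes b_2))=H(b_1\otimes b_2)$ if $i\ne0$; $=H(b_1\otimes b_2)-1$ if $i=0$ and $\varphi_0(b_1)>\varepsilon_0(b_2)$; $=H(b_1\otimes b_2)+1$ if $i=0$ and $\varphi_0(b_1)\le\varepsilon_0(b_2)$. **Shifted energy function.** For $b_1,b_2\in B$, $$F(b_1\otimes b_2)=\operatorname{ht}(\delta)\,H(b_1\otimes b_2)+\operatorname{ht}(\overline{\mathrm{wt}}(b_1))-\operatorname{ht}(\overline{\mathrm{wt}}(b_2)).$$ *)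

theory Defs
  imports Main
begin

section \<open>Affine types and the finite root system\<close>

datatype affine_type = G2_1 | D4_3 | F4_1 | E6_2 | E6_1 | E7_1 | E8_1

fun rank :: "affine_type \<Rightarrow> nat" where
  "rank G2_1 = 2"
| "rank D4_3 = 2"
| "rank F4_1 = 4"
| "rank E6_2 = 4"
| "rank E6_1 = 6"
| "rank E7_1 = 7"
| "rank E8_1 = 8"

abbreviation nodes :: "affine_type \<Rightarrow> nat set" where
  "nodes X \<equiv> {0..rank X}"

abbreviation fin_nodes :: "affine_type \<Rightarrow> nat set" where
  "fin_nodes X \<equiv> {1..rank X}"

text \<open>The affine Dynkin diagrams, with the nodes numbered as in Kac, Infinite dimensional Lie
  algebras. A diagram is given by its edges together with the relative squared lengths of the
  simple roots: \<open>sq_len X i\<close> is \<open>(\<alpha>\<^sub>i, \<alpha>\<^sub>i) / 2\<close>, scaled such that short roots get \<open>1\<close>.\<close>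

fun edges :: "affine_type \<Rightarrow> (nat \<times> nat) set" where
  "edges G2_1 = {(0,1), (1,2)}"
| "edges D4_3 = {(0,1), (1,2)}"
| "edges F4_1 = {(0,1), (1,2), (2,3), (3,4)}"
| "edges E6_2 = {(0,1), (1,2), (2,3), (3,4)}"
| "edges E6_1 = {(1,2), (2,3), (3,4), (4,5), (3,6), (6,0)}"
| "edges E7_1 = {(0,1), (1,2), (2,3), (3,4), (4,5), (5,6), (3,7)}"
| "edges E8_1 = {(0,1), (1,2), (2,3), (3,4), (4,5), (5,6), (6,7), (5,8)}"

fun sq_len :: "affine_type \<Rightarrow> nat \<Rightarrow> int" where
  "sq_len G2_1 i = (if i \<in> {0,1} then 3 else 1)"
| "sq_len D4_3 i = (if i \<in> {0,1} then 1 else 3)"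
| "sq_len F4_1 i = (if i \<in> {0,1,2} then 2 else 1)"
| "sq_len E6_2 i = (if i \<in> {0,1,2} then 1 else 2)"
| "sq_len E6_1 i = 1"
| "sq_len E7_1 i = 1"
| "sq_len E8_1 i = 1"

text \<open>\<open>simple_form X i j\<close> is \<open>(\<alpha>\<^sub>i, \<alpha>\<^sub>j)\<close>. For adjacent nodes the longer of the two simple roots
  has Cartan integer \<open>-1\<close>, hence the value below. In \<open>cartan\<close>, where
  \<open>a\<^sub>i\<^sub>j = 2 (\<alpha>\<^sub>i, \<alpha>\<^sub>j) / (\<alpha>\<^sub>i, \<alpha>\<^sub>i) = \<langle>\<alpha>\<^sub>i\<^sup>\<or>, \<alpha>\<^sub>j\<rangle>\<close>, the division is exact.\<close>

definition simple_form :: "affine_type \<Rightarrow> nat \<Rightarrow> nat \<Rightarrow> int" where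
  "simple_form X i j =
     (if i = j then 2 * sq_len X i
      else if (i, j) \<in> edges X \<or> (j, i) \<in> edges X then - max (sq_len X i) (sq_len X j)
      else 0)"

definition cartan :: "affine_type \<Rightarrow> nat \<Rightarrow> nat \<Rightarrow> int" where
  "cartan X i j = (2 * simple_form X i j) div simple_form X i i"

text \<open>An element \<open>\<Sum>\<^sub>j c\<^sub>j \<alpha>\<^sub>j\<close> of the root lattice, with \<open>j\<close> ranging over the finite nodes or over
  all nodes, is the function \<open>j \<mapsto> c\<^sub>j\<close>, which vanishes at all other indices.\<close>

type_synonym root_lattice = "nat \<Rightarrow> int"

definition simple_root :: "nat \<Rightarrow> root_lattice" where
  "simple_root i = (\<lambda>j. if j = i then 1 else 0)"

definition simple_reflection :: "affine_type \<Rightarrow> nat \<Rightarrow> root_lattice \<Rightarrow> root_lattice" where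
  "simple_reflection X i \<beta> =
     (\<lambda>k. \<beta> k - (\<Sum>j\<in>fin_nodes X. cartan X i j * \<beta> j) * simple_root i k)"

text \<open>The finite root system \<open>\<Phi>\<^sup>0\<close> obtained by removing the node \<open>0\<close>: the orbits of the remaining
  simple roots under the group generated by their reflections.\<close>

inductive_set roots :: "affine_type \<Rightarrow> root_lattice set" for X where
  simple: "i \<in> fin_nodes X \<Longrightarrow> simple_root i \<in> roots X"
| reflect: "\<beta> \<in> roots X \<Longrightarrow> i \<in> fin_nodes X \<Longrightarrow> simple_reflection X i \<beta> \<in> roots X"

definition sq_norm :: "affine_type \<Rightarrow> root_lattice \<Rightarrow> int" where
  "sq_norm X \<beta> = (\<Sum>i\<in>fin_nodes X. \<Sum>j\<in>fin_nodes X. \<beta> i * \<beta> j * simple_form X i j)"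

definition short_roots :: "affine_type \<Rightarrow> root_lattice set" where
  "short_roots X = {\<beta> \<in> roots X. \<forall>\<gamma>\<in>roots X. sq_norm X \<beta> \<le> sq_norm X \<gamma>}"

definition R :: "affine_type \<Rightarrow> root_lattice set" where
  "R X = (if X \<in> {D4_3, E6_2} then short_roots X else roots X)"

definition Rpos :: "affine_type \<Rightarrow> root_lattice set" where
  "Rpos X = {\<alpha> \<in> R X. \<forall>j. 0 \<le> \<alpha> j}"

definition Rneg :: "affine_type \<Rightarrow> root_lattice set" where
  "Rneg X = {\<alpha> \<in> R X. \<forall>j. \<alpha> j \<le> 0}"

text \<open>\<open>\<Sigma>\<close>, represented by the indices of the simple roots in it.\<close>

definition Sigma_idx :: "affine_type \<Rightarrow> nat set" where
  "Sigma_idx X = {i \<in> fin_nodes X. simple_root i \<in> R X}"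

definition theta :: "affine_type \<Rightarrow> root_lattice" where
  "theta X = (THE \<theta>. \<theta> \<in> R X \<and> (\<forall>\<beta>\<in>R X. \<forall>j. \<beta> j \<le> \<theta> j))"

definition delta :: "affine_type \<Rightarrow> root_lattice" where
  "delta X = (\<lambda>j. simple_root 0 j + theta X j)"

definition ht :: "affine_type \<Rightarrow> root_lattice \<Rightarrow> int" where
  "ht X \<alpha> = (\<Sum>j\<in>nodes X. \<alpha> j)"

section \<open>The crystal\<close>

text \<open>\<open>Bx \<alpha>\<close> is \<open>x\<^sub>\<alpha>\<close> and \<open>Br i\<close> is \<open>r\<close> indexed by \<open>\<alpha>\<^sub>i\<close>.\<close>

datatype crystal_elt = Bx root_lattice | Br nat | Bphi

definition B :: "affine_type \<Rightarrow> crystal_elt set" where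
  "B X = Bx ` (Rpos X \<union> Rneg X) \<union> Br ` Sigma_idx X \<union> {Bphi}"

inductive arrow :: "affine_type \<Rightarrow> nat \<Rightarrow> crystal_elt \<Rightarrow> crystal_elt \<Rightarrow> bool" for X where
  x_x: "\<lbrakk>i \<in> fin_nodes X; \<alpha> \<in> Rpos X \<union> Rneg X; \<beta> \<in> Rpos X \<union> Rneg X;
          (\<lambda>j. \<alpha> j - simple_root i j) = \<beta>\<rbrakk> \<Longrightarrow> arrow X i (Bx \<alpha>) (Bx \<beta>)"
| x_r: "i \<in> Sigma_idx X \<Longrightarrow> arrow X i (Bx (simple_root i)) (Br i)"
| r_x: "i \<in> Sigma_idx X \<Longrightarrow> arrow X i (Br i) (Bx (\<lambda>j. - simple_root i j))"
| x_x_0: "\<lbrakk>\<alpha> \<in> Rneg X - {\<lambda>j. - theta X j}; \<beta> \<in> Rpos X;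
            (\<lambda>j. \<alpha> j + theta X j) = \<beta>\<rbrakk> \<Longrightarrow> arrow X 0 (Bx \<alpha>) (Bx \<beta>)"
| x_phi_0: "arrow X 0 (Bx (\<lambda>j. - theta X j)) Bphi"
| phi_x_0: "arrow X 0 Bphi (Bx (theta X))"

text \<open>The value \<open>0\<close> of the Kashiwara operators is \<open>None\<close>. For each label, every element has at
  most one outgoing and at most one incoming arrow.\<close>

definition f_op :: "affine_type \<Rightarrow> nat \<Rightarrow> crystal_elt \<Rightarrow> crystal_elt option" where
  "f_op X i b = (if \<exists>b'. arrow X i b b' then Some (THE b'. arrow X i b b') else None)"

definition e_op :: "affine_type \<Rightarrow> nat \<Rightarrow> crystal_elt \<Rightarrow> crystal_elt option" where
  "e_op X i b' = (if \<exists>b. arrow X i b b' then Some (THE b. arrow X i b b') else None)"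

definition iter_op :: "('a \<Rightarrow> 'a option) \<Rightarrow> nat \<Rightarrow> 'a \<Rightarrow> 'a option" where
  "iter_op g k b = ((\<lambda>u. Option.bind u g) ^^ k) (Some b)"

definition eps :: "affine_type \<Rightarrow> nat \<Rightarrow> crystal_elt \<Rightarrow> nat" where
  "eps X i b = Max {k. iter_op (e_op X i) k b \<noteq> None}"

definition phi :: "affine_type \<Rightarrow> nat \<Rightarrow> crystal_elt \<Rightarrow> nat" where
  "phi X i b = Max {k. iter_op (f_op X i) k b \<noteq> None}"

fun cl_wt :: "crystal_elt \<Rightarrow> root_lattice" where
  "cl_wt (Bx \<alpha>) = \<alpha>"
| "cl_wt (Br i) = (\<lambda>_. 0)"
| "cl_wt Bphi = (\<lambda>_. 0)"

fun f_tensor :: "affine_type \<Rightarrow> nat \<Rightarrow> crystal_elt \<times> crystal_elt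
    \<Rightarrow> (crystal_elt \<times> crystal_elt) option" where
  "f_tensor X i (b1, b2) =
     (if phi X i b1 > eps X i b2 then map_option (\<lambda>b. (b, b2)) (f_op X i b1)
      else map_option (\<lambda>b. (b1, b)) (f_op X i b2))"

section \<open>Energy functions\<close>

text \<open>Since the tensor square of \<open>B\<close> is connected, these conditions determine \<open>H\<close> on
  \<open>B X \<times> B X\<close>; its values elsewhere are irrelevant.\<close>

definition energy_function :: "affine_type \<Rightarrow> (crystal_elt \<times> crystal_elt \<Rightarrow> int) \<Rightarrow> bool" where
  "energy_function X H \<longleftrightarrow>
     H (Bphi, Bphi) = 0 \<and>
     (\<forall>i\<in>nodes X. \<forall>b1\<in>B X. \<forall>b2\<in>B X. f_tensor X i (b1, b2) \<noteq> None \<longrightarrow>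
        H (the (f_tensor X i (b1, b2))) =
          (if i \<noteq> 0 then H (b1, b2)
           else if phi X 0 b1 > eps X 0 b2 then H (b1, b2) - 1
           else H (b1, b2) + 1))"

fun shifted_energy :: "affine_type \<Rightarrow> (crystal_elt \<times> crystal_elt \<Rightarrow> int)
    \<Rightarrow> crystal_elt \<times> crystal_elt \<Rightarrow> int" where
  "shifted_energy X H (b1, b2) =
     ht X (delta X) * H (b1, b2) + ht X (cl_wt b1) - ht X (cl_wt b2)"

end

theory Submission imports Defs begin

text \<open>Every arrow with a label \<open>i \<noteq> 0\<close> lowers the height of the classical weight by \<open>1\<close>, and every
  \<open>0\<close>-arrow raises it by \<open>ht \<theta> = ht \<delta> - 1\<close>. So in a step of label \<open>i \<noteq> 0\<close> only the height terms of
  the shifted energy change, while in a step of label \<open>0\<close> the term \<open>ht \<delta> \<cdot> H\<close> changes by \<open>ht \<delta>\<close> and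
  the height terms by \<open>ht \<delta> - 1\<close> in the opposite direction. Arrows are unique, so that \<open>f_op\<close>
  follows them, because \<open>0\<close> is not a root: otherwise both \<open>r\<close> and \<open>x\<^sub>0\<close> would follow \<open>x\<^sub>\<alpha>\<close> for a
  simple root \<open>\<alpha>\<close>.\<close>

lemma ht_add: "ht X (\<lambda>j. \<alpha> j + \<beta> j) = ht X \<alpha> + ht X \<beta>"
  by (simp add: ht_def sum.distrib)

lemma ht_diff: "ht X (\<lambda>j. \<alpha> j - \<beta> j) = ht X \<alpha> - ht X \<beta>"
  by (simp add: ht_def sum_subtractf)

lemma ht_uminus: "ht X (\<lambda>j. - \<alpha> j) = - ht X \<alpha>"
  by (simp add: ht_def sum_negf)

lemma ht_zero: "ht X (\<lambda>_. 0) = 0"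
  by (simp add: ht_def)

lemma ht_simple_root: "i \<in> nodes X \<Longrightarrow> ht X (simple_root i) = 1"
  by (simp add: ht_def simple_root_def)

lemma ht_delta: "ht X (delta X) = 1 + ht X (theta X)"
  by (simp add: delta_def ht_add ht_simple_root)

lemma cartan_diag: "cartan X i i = 2"
  by (cases X) (simp_all add: cartan_def simple_form_def)

text \<open>If the reflection vanishes, \<open>\<beta>\<close> is \<open>c\<close> times the simple
  root, \<open>c\<close> being its pairing with the coroot. As the diagonal Cartan entry is 2, that
  pairing is also \<open>2 * c\<close>, so \<open>c = 0\<close>.\<close>

lemma simple_reflection_eq_zero:
  assumes "i \<in> fin_nodes X" and "simple_reflection X i \<beta> = (\<lambda>_. 0)"
  shows "\<beta> = (\<lambda>_. 0)"
proof -
  define c where "c = (\<Sum>j\<in>fin_nodes X. cartan X i j * \<beta> j)"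
  have \<beta>: "\<beta> j = c * simple_root i j" for j
    using fun_cong[OF assms(2), of j] by (simp add: simple_reflection_def c_def)
  have "c = (\<Sum>j\<in>fin_nodes X. if j = i then 2 * c else 0)"
    unfolding c_def[symmetric]
    by (subst c_def, rule sum.cong) (auto simp: \<beta> simple_root_def cartan_diag)
  then have "c = 0"
    using assms(1) by simp
  then show ?thesis
    by (simp add: fun_eq_iff \<beta>)
qed

lemma root_nonzero: "\<alpha> \<in> roots X \<Longrightarrow> \<alpha> \<noteq> (\<lambda>_. 0)"
proof (induction rule: roots.induct)
  case (simple i)
  then show ?case
    by (auto simp: simple_root_def fun_eq_iff)
next
  case (reflect \<beta> i)
  then show ?case
    using simple_reflection_eq_zero by blast
qed

lemma Rpos_Rneg_nonzero: "(\<lambda>_. 0) \<notin> Rpos X \<union> Rneg X"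
  using root_nonzero by (auto simp: Rpos_def Rneg_def R_def short_roots_def split: if_splits)

lemma arrow_functional:
  assumes "arrow X i b b'" and "arrow X i b b''"
  shows "b' = b''"
  using assms Rpos_Rneg_nonzero[of X]
  by (auto elim!: arrow.cases simp: Sigma_idx_def)

lemma arrow_f_op:
  assumes "f_op X i b = Some b'"
  shows "arrow X i b b'"
proof -
  from assms obtain b'' where b'': "arrow X i b b''" and b': "b' = (THE c. arrow X i b c)"
    by (auto simp: f_op_def split: if_splits)
  from b'' have "(THE c. arrow X i b c) = b''"
    by (blast intro: the_equality arrow_functional)
  with b'' b' show ?thesis
    by simp
qed

lemma ht_arrow:
  assumes "arrow X i b b'"
  shows "ht X (cl_wt b') = ht X (cl_wt b) + (if i = 0 then ht X (theta X) else - 1)"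
  using assms
proof cases
  case (x_x \<alpha> \<beta>)
  then have "ht X \<beta> = ht X (\<lambda>j. \<alpha> j - simple_root i j)"
    by simp
  with x_x(1-3) show ?thesis
    by (simp add: ht_diff ht_simple_root)
qed (auto simp: ht_add ht_uminus ht_zero ht_simple_root Sigma_idx_def)

theorem lemma6p2:
  fixes X :: affine_type
    and H :: "crystal_elt \<times> crystal_elt \<Rightarrow> int"
    and i :: nat
    and b1 b2 :: crystal_elt
  assumes "energy_function X H"
    and "i \<in> nodes X"
    and "b1 \<in> B X" and "b2 \<in> B X"
    and "f_tensor X i (b1, b2) \<noteq> None"
  shows "shifted_energy X H (the (f_tensor X i (b1, b2))) =
    (if phi X i b1 > eps X i b2 then shifted_energy X H (b1, b2) - 1
     else shifted_energy X H (b1, b2) + 1)"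
proof -
  have H: "H (the (f_tensor X i (b1, b2))) =
      (if i \<noteq> 0 then H (b1, b2)
       else if phi X i b1 > eps X i b2 then H (b1, b2) - 1
       else H (b1, b2) + 1)"
    using assms unfolding energy_function_def by auto
  show ?thesis
  proof (cases "phi X i b1 > eps X i b2")
    case True
    with assms(5) obtain b where b: "f_op X i b1 = Some b"
      by auto
    from ht_arrow[OF arrow_f_op[OF b]] H True b show ?thesis
      by (auto simp: ht_delta algebra_simps)
  next
    case False
    with assms(5) obtain b where b: "f_op X i b2 = Some b"
      by auto
    \<comment> \<open>Now the second factor moves. Its height enters with a minus sign, so the
      change is \<open>- (- 1) = 1\<close> for \<open>i \<noteq> 0\<close> and
      \<open>ht \<delta> - ht \<theta> = 1\<close> for \<open>i = 0\<close>.\<close>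
    from ht_arrow[OF arrow_f_op[OF b]] H False b show ?thesis
      by (auto simp: ht_delta algebra_simps)
  qed
qed

end
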